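(* Let $A=[a_1\ \cdots\ a_n]\in\mathbb{R}^{d\times n}$ with $\|a_i\|=1$ for $i=1,\dots,n$. Assume there exists $p\ge\mathbf{0}$, $p\ne\mathbf{0}$, with $Ap=\mathbf{0}$, and assume $|\rho_A^-|>0$. Let $W=\{\alpha\in\triangle : A\alpha=\mathbf{0}\}$. If $w_t=A\alpha_t$ is a sequence of Normalized Perceptron iterates, then for every $t\ge1$, $$\mathrm{dist}_1(\alpha_t,W)\le\frac{2}{|\rho_A^-|\sqrt{t}},$$ where $\mathrm{dist}_1(\alpha,W)=\inf_{q\in W}\|\alpha-q\|_1$.
   Context: $\mathrm{lin}(A)=\{A\alpha:\alpha\in\mathbb{R}^n\}$ is the linear span of the columns of $A$; $\triangle=\{p\in\mathbb{R}^n: p\ge\mathbf{0},\ \|p\|_1=1\}$ is the probability simplex; $\|\cdot\|$ is the Euclidean norm. The affine-margin is $\rho_A:=\sup\{\inf_{p\in\triangle}w^TAp : w\in\mathrm{lin}(A),\ \|w\|=1\}$ and $\rho_A^-:=\min\{0,\rho_A\}$. Normalized Perceptron (NP): start with $w_0=a_{i_0}$ for an arbitrary index $i_0$; for $t=1,2,\dots$ choose an index $i_t\in\arg\min_{i}\{w_{t-1}^Ta_i\}$ (ties broken arbitrarily) and set $w_t=(1-\tfrac1t)w_{t-1}+\tfrac1t a_{i_t}$. The corresponding coefficient vectors are $\alpha_0=e_{i_0}$, $\alpha_t=(1-\tfrac1t)\alpha_{t-1}+\tfrac1t e_{i_t}$ (with $e_i$ the standard basis vectors of $\mathbb{R}^n$),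 so $\alpha_t\in\triangle$ and $w_t=A\alpha_t$. *)

theory Defs
  imports "HOL-Analysis.Analysis"
begin

(* The columns a_i of a matrix A with d rows and n columns (A :: real^'n^'d) are "column i A". *)

definition l1_norm :: "real^'n \<Rightarrow> real" where
  "l1_norm x = (\<Sum>i\<in>UNIV. \<bar>x $ i\<bar>)"

definition prob_simplex :: "(real^'n) set" where
  "prob_simplex = {p. 0 \<le> p \<and> l1_norm p = 1}"

definition lin :: "real^'n^'d \<Rightarrow> (real^'d) set" where
  "lin A = range (\<lambda>\<alpha>. A *v \<alpha>)"

(* Real-valued SUP and INF are only meaningful on nonempty, suitably bounded sets. The infimum
   ranges over a compact nonempty set, and the suprema are bounded above by the largest column
   norm; the outer index set is nonempty as soon as A is nonzero. *)
definition affine_margin :: "real^'n^'d \<Rightarrow> real" where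
  "affine_margin A = (SUP w\<in>{w \<in> lin A. norm w = 1}. INF p\<in>prob_simplex. w \<bullet> (A *v p))"

definition affine_margin_neg :: "real^'n^'d \<Rightarrow> real" where
  "affine_margin_neg A = min 0 (affine_margin A)"

definition dist1 :: "real^'n \<Rightarrow> (real^'n) set \<Rightarrow> real" where
  "dist1 \<alpha> W = (INF q\<in>W. l1_norm (\<alpha> - q))"

(* A run of the Normalized Perceptron: idx is the sequence of chosen indices, w the iterates and
   \<alpha> their coefficient vectors. The start idx 0 is arbitrary, and idx t may be any minimiser,
   so every tie-breaking rule is covered. *)
definition normalized_perceptron ::
  "real^'n^'d \<Rightarrow> (nat \<Rightarrow> 'n) \<Rightarrow> (nat \<Rightarrow> real^'d) \<Rightarrow> (nat \<Rightarrow> real^'n) \<Rightarrow> bool" where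
  "normalized_perceptron A idx w \<alpha> \<longleftrightarrow>
     w 0 = column (idx 0) A \<and>
     \<alpha> 0 = axis (idx 0) 1 \<and>
     (\<forall>t\<ge>1.
        is_arg_min (\<lambda>i. w (t - 1) \<bullet> column i A) (\<lambda>i. True) (idx t) \<and>
        w t = (1 - 1 / real t) *\<^sub>R w (t - 1) + (1 / real t) *\<^sub>R column (idx t) A \<and>
        \<alpha> t = (1 - 1 / real t) *\<^sub>R \<alpha> (t - 1) + (1 / real t) *\<^sub>R axis (idx t) 1)"

end

theory Submission
  imports Defs
begin

text \<open>
  Let \<open>\<rho> = - \<rho>\<^sub>A > 0\<close>. By separation, the image of the simplex under \<open>A\<close> contains every vector of
  norm \<open>\<rho>\<close> in \<open>lin A\<close>: a separating functional, projected to \<open>lin A\<close> and normalised, would have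
  margin larger than \<open>\<rho>\<^sub>A\<close>. So for \<open>\<alpha>\<close> in the simplex with \<open>v = A \<alpha> \<noteq> 0\<close> there is \<open>\<beta>\<close> in the simplex with
  \<open>A \<beta> = - (\<rho> / \<parallel>v\<parallel>) v\<close>. The point of the segment from \<open>\<alpha>\<close> to \<open>\<beta>\<close> annihilated by \<open>A\<close> is at
  distance at most \<open>2 \<parallel>v\<parallel> / \<rho>\<close> from \<open>\<alpha>\<close>. Finally \<open>\<parallel>w\<^sub>t\<parallel> \<le> 1 / \<surd>t\<close>: by dual feasibility the
  selected column makes a nonpositive inner product with \<open>w\<^sub>t\<^sub>-\<^sub>1\<close>, so \<open>\<parallel>t w\<^sub>t\<parallel>\<^sup>2\<close> grows by at most
  \<open>1\<close> per step.
\<close>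

lemma l1_norm_nonneg: "0 \<le> l1_norm x"
  unfolding l1_norm_def by (simp add: sum_nonneg)

lemma l1_norm_scaleR: "l1_norm (c *\<^sub>R x) = \<bar>c\<bar> * l1_norm x"
  unfolding l1_norm_def by (simp add: abs_mult sum_distrib_left)

lemma l1_norm_diff_le: "l1_norm (x - y) \<le> l1_norm x + l1_norm y"
  unfolding l1_norm_def sum.distrib[symmetric] by (intro sum_mono) simp

lemma norm_le_l1_norm: "norm x \<le> l1_norm x"
  unfolding l1_norm_def by (rule norm_le_l1_cart)

lemma mem_prob_simplex_iff:
  "p \<in> prob_simplex \<longleftrightarrow> (\<forall>i. 0 \<le> p $ i) \<and> (\<Sum>i\<in>UNIV. p $ i) = 1"
  unfolding prob_simplex_def l1_norm_def less_eq_vec_def by auto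

lemma axis_mem_prob_simplex: "axis i 1 \<in> prob_simplex"
  unfolding mem_prob_simplex_iff by (auto simp: axis_def)

lemma convex_prob_simplex: "convex prob_simplex"
  unfolding convex_def
  by (auto simp: mem_prob_simplex_iff sum.distrib sum_distrib_left[symmetric])

lemma compact_prob_simplex: "compact (prob_simplex :: (real^'n) set)"
proof -
  have "closed ({p. \<forall>i. 0 \<le> p $ i} :: (real^'n) set)"
    by (intro closed_Collect_all closed_Collect_le continuous_intros)
  moreover have "closed {p :: real^'n. (\<Sum>i\<in>UNIV. p $ i) = 1}"
    by (intro closed_Collect_eq continuous_intros)
  ultimately have "closed ({p. \<forall>i. 0 \<le> p $ i} \<inter> {p. (\<Sum>i\<in>UNIV. p $ i) = 1} :: (real^'n) set)"
    by (rule closed_Int)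
  moreover have "({p. \<forall>i. 0 \<le> p $ i} \<inter> {p. (\<Sum>i\<in>UNIV. p $ i) = 1} :: (real^'n) set) = prob_simplex"
    by (auto simp: mem_prob_simplex_iff)
  moreover have "bounded (prob_simplex :: (real^'n) set)"
    unfolding bounded_iff prob_simplex_def
    by (intro exI[of _ 1] ballI) (metis (mono_tags, lifting) mem_Collect_eq norm_le_l1_norm)
  ultimately show ?thesis
    by (simp add: compact_eq_bounded_closed)
qed

lemma subspace_lin: "subspace (lin A)"
  unfolding lin_def
  by (intro linear_subspace_image matrix_vector_mul_linear subspace_UNIV)

lemma INF_le_affine_margin:
  fixes A :: "real^'n^'d"
  assumes "w \<in> lin A" "norm w = 1"
  shows "(INF p\<in>prob_simplex. w \<bullet> (A *v p)) \<le> affine_margin A"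
  unfolding affine_margin_def
proof (rule cSUP_upper)
  show "w \<in> {w \<in> lin A. norm w = 1}" using assms by simp
  \<comment> \<open>A conditionally complete supremum needs an upper bound uniform in
    \<open>v\<close>. Evaluating the infimum at a single vertex, here of arbitrary index, gives the
    norm of one column.\<close>
  let ?p = "axis undefined 1 :: real^'n"
  show "bdd_above ((\<lambda>w. INF p\<in>prob_simplex. w \<bullet> (A *v p)) ` {w \<in> lin A. norm w = 1})"
  proof (rule bdd_aboveI2)
    fix v assume v: "v \<in> {w \<in> lin A. norm w = 1}"
    have "compact ((\<lambda>p. v \<bullet> (A *v p)) ` prob_simplex)"
      by (intro compact_continuous_image compact_prob_simplex continuous_intros)
    then have "(INF p\<in>prob_simplex. v \<bullet> (A *v p)) \<le> v \<bullet> (A *v ?p)"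
      by (intro cINF_lower axis_mem_prob_simplex bounded_imp_bdd_below compact_imp_bounded)
    also have "\<dots> \<le> norm (A *v ?p)"
      using norm_cauchy_schwarz[of v "A *v ?p"] v by simp
    finally show "(INF p\<in>prob_simplex. v \<bullet> (A *v p)) \<le> norm (A *v ?p)" .
  qed
qed

lemma mem_image_prob_simplex:
  fixes A :: "real^'n^'d"
  assumes u: "u \<in> lin A" and norm_u: "norm u \<le> - affine_margin A"
  shows "u \<in> (\<lambda>p. A *v p) ` prob_simplex"
proof (rule ccontr)
  let ?S = "(\<lambda>p. A *v p) ` prob_simplex"
  assume "u \<notin> ?S"
  moreover have "convex ?S"
    by (intro convex_linear_image matrix_vector_mul_linear convex_prob_simplex)
  moreover have "closed ?S"
    by (intro compact_imp_closed compact_continuous_image compact_prob_simplex continuous_intros)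
  ultimately obtain x b where x: "x \<bullet> u < b" "\<And>p. p \<in> prob_simplex \<Longrightarrow> b < x \<bullet> (A *v p)"
    using separating_hyperplane_closed_point[of ?S u] by auto
  \<comment> \<open>The margin ranges only over unit vectors of \<open>lin A\<close>, so the
    separating normal \<open>x\<close> is replaced by its projection \<open>y\<close>, which acts
    identically on \<open>lin A\<close>.\<close>
  obtain y z where y: "y \<in> lin A" and z: "\<And>v. v \<in> lin A \<Longrightarrow> orthogonal z v" and xyz: "x = y + z"
    using orthogonal_subspace_decomp_exists[of "lin A" x] span_eq_iff[of "lin A"] subspace_lin
    by metis
  have xy: "x \<bullet> v = y \<bullet> v" if "v \<in> lin A" for v
    using z[OF that] by (simp add: xyz inner_add_left orthogonal_def)
  have yu: "y \<bullet> u < b" using x(1) xy[OF u] by simp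
  have yp: "b \<le> y \<bullet> (A *v p)" if "p \<in> prob_simplex" for p
    using x(2)[OF that] xy[of "A *v p"] by (auto simp: lin_def)
  have "y \<bullet> u < y \<bullet> (A *v axis undefined 1)"
    using yu yp[OF axis_mem_prob_simplex] by (rule less_le_trans)
  then have "y \<noteq> 0" by auto
  then have ny: "norm y > 0" by simp
  define v where "v = (1 / norm y) *\<^sub>R y"
  have v: "v \<in> lin A" "norm v = 1"
    using y ny subspace_lin[of A] by (auto simp: v_def subspace_scale)
  \<comment> \<open>The chain starts and ends at \<open>b / norm y\<close>, with one strict
    inequality: the margin is at least this, yet at most \<open>- norm u\<close>, hence at most
    \<open>v \<bullet> u\<close>.\<close>
  have "b / norm y \<le> (INF p\<in>prob_simplex. v \<bullet> (A *v p))"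
  proof (rule cINF_greatest)
    show "(prob_simplex :: (real^'n) set) \<noteq> {}" using axis_mem_prob_simplex by blast
    show "b / norm y \<le> v \<bullet> (A *v p)" if "p \<in> prob_simplex" for p
      using yp[OF that] ny by (simp add: v_def divide_right_mono)
  qed
  also have "\<dots> \<le> affine_margin A" by (rule INF_le_affine_margin[OF v])
  also have "\<dots> \<le> - norm u" using norm_u by simp
  also have "\<dots> \<le> v \<bullet> u"
    using Cauchy_Schwarz_ineq2[of v u] v(2) by simp
  also have "\<dots> < b / norm y"
    using yu ny by (simp add: v_def divide_strict_right_mono)
  finally show False by simp
qed

text \<open>An error bound of Hoffman type: the residual \<open>A *v \<alpha>\<close> controls the
  distance to the solution set. The factor 2 bounds the \<open>l1_norm\<close> diameter of the
  simplex.\<close>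

lemma dist1_kernel_le:
  fixes A :: "real^'n^'d"
  assumes margin: "affine_margin A < 0" and a: "\<alpha> \<in> prob_simplex"
  shows "dist1 \<alpha> {q \<in> prob_simplex. A *v q = 0} \<le> 2 * norm (A *v \<alpha>) / - affine_margin A"
proof -
  define r where "r = - affine_margin A"
  define n where "n = norm (A *v \<alpha>)"
  have r: "r > 0" and n: "n \<ge> 0" using margin by (simp_all add: r_def n_def)
  \<comment> \<open>The weight solving \<open>1 - c - c * (r / n) = 0\<close>, so that the two
    images cancel. If \<open>n = 0\<close>, division by zero gives \<open>r / n = 0\<close> and
    \<open>c = 0\<close>, and the construction returns \<open>q = \<alpha>\<close>.\<close>
  define c where "c = n / (r + n)"
  have c: "0 \<le> c" "c \<le> 1" using r n by (auto simp: c_def)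
  have "- (r / n) *\<^sub>R (A *v \<alpha>) \<in> (\<lambda>p. A *v p) ` prob_simplex"
  proof (rule mem_image_prob_simplex)
    show "- (r / n) *\<^sub>R (A *v \<alpha>) \<in> lin A"
      by (intro subspace_scale[OF subspace_lin]) (auto simp: lin_def)
    show "norm (- (r / n) *\<^sub>R (A *v \<alpha>)) \<le> - affine_margin A"
      using r n by (cases "n = 0") (auto simp: n_def[symmetric] r_def[symmetric])
  qed
  then obtain \<beta> where b: "\<beta> \<in> prob_simplex" "A *v \<beta> = - (r / n) *\<^sub>R (A *v \<alpha>)"
    by auto
  define q where "q = (1 - c) *\<^sub>R \<alpha> + c *\<^sub>R \<beta>"
  have q: "q \<in> prob_simplex"
    unfolding q_def using a b(1) c by (intro convexD[OF convex_prob_simplex]) auto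
  have "A *v q = (1 - c - c * (r / n)) *\<^sub>R (A *v \<alpha>)"
    by (simp add: q_def matrix_vector_right_distrib matrix_vector_mult_scaleR b(2) algebra_simps)
  also have "\<dots> = 0"
  proof (cases "n = 0")
    case True
    then show ?thesis by (simp add: n_def)
  next
    case False
    then have "1 - c - c * (r / n) = 0"
      using r n by (simp add: c_def field_simps)
    then show ?thesis by simp
  qed
  finally have "dist1 \<alpha> {q \<in> prob_simplex. A *v q = 0} \<le> l1_norm (\<alpha> - q)"
    unfolding dist1_def using q
    by (intro cINF_lower bdd_belowI2[where m = 0]) (auto simp: l1_norm_nonneg)
  also have "\<alpha> - q = c *\<^sub>R (\<alpha> - \<beta>)" by (simp add: q_def algebra_simps)
  also have "l1_norm \<dots> = c * l1_norm (\<alpha> - \<beta>)" using c by (simp add: l1_norm_scaleR)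
  also have "\<dots> \<le> c * 2"
    using l1_norm_diff_le[of \<alpha> \<beta>] a b(1) c by (intro mult_left_mono) (auto simp: prob_simplex_def)
  also have "\<dots> \<le> 2 * n / r"
    using r n by (simp add: c_def frac_le)
  finally show ?thesis by (simp add: n_def r_def)
qed

text \<open>The easy direction of Gordan's alternative: weighting the inner products by
  \<open>p\<close> gives \<open>w \<bullet> (A *v p) = 0\<close>, which rules out all of them being
  positive.\<close>

lemma exists_column_inner_nonpos:
  fixes A :: "real^'n^'d"
  assumes "0 \<le> p" "p \<noteq> 0" "A *v p = 0"
  shows "\<exists>i. w \<bullet> column i A \<le> 0"
proof (rule ccontr)
  assume "\<not> ?thesis"
  then have pos: "0 < w \<bullet> column i A" for i by (simp add: not_le)
  have p: "0 \<le> p $ i" for i using assms(1) by (simp add: less_eq_vec_def)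
  obtain k where k: "p $ k \<noteq> 0" using assms(2) by (auto simp: vec_eq_iff)
  have "0 < (\<Sum>i\<in>UNIV. p $ i * (w \<bullet> column i A))"
    using p[of k] k pos[of k]
    by (intro sum_pos2[of _ k]) (auto intro!: mult_nonneg_nonneg p less_imp_le[OF pos])
  also have "\<dots> = w \<bullet> (A *v p)"
    by (simp add: matrix_mult_sum inner_sum_right scalar_mult_eq_scaleR)
  finally show False using assms(3) by simp
qed

context
  fixes A :: "real^'n^'d" and idx w \<alpha>
  assumes NP: "normalized_perceptron A idx w \<alpha>"
begin

lemma perceptron_start: "w 0 = column (idx 0) A" "\<alpha> 0 = axis (idx 0) 1"
  using NP by (auto simp: normalized_perceptron_def)

lemma perceptron_step:
  "w (Suc t) = (1 - 1 / real (Suc t)) *\<^sub>R w t + (1 / real (Suc t)) *\<^sub>R column (idx (Suc t)) A"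
  "\<alpha> (Suc t) = (1 - 1 / real (Suc t)) *\<^sub>R \<alpha> t + (1 / real (Suc t)) *\<^sub>R axis (idx (Suc t)) 1"
  "w t \<bullet> column (idx (Suc t)) A \<le> w t \<bullet> column i A"
  using NP[unfolded normalized_perceptron_def, THEN conjunct2, THEN conjunct2, rule_format, of "Suc t"]
  by (auto simp: is_arg_min_def not_less simp del: of_nat_Suc)

lemma perceptron_coefficients_mem: "\<alpha> t \<in> prob_simplex"
proof (induction t)
  case 0
  then show ?case by (simp add: perceptron_start axis_mem_prob_simplex)
next
  case (Suc t)
  then show ?case
    unfolding perceptron_step
    by (intro convexD[OF convex_prob_simplex] axis_mem_prob_simplex) auto
qed

lemma perceptron_iterate_eq: "w t = A *v \<alpha> t"
proof (induction t)
  case 0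
  then show ?case by (simp add: perceptron_start matrix_vector_mult_basis)
next
  case (Suc t)
  then show ?case
    unfolding perceptron_step
    by (simp add: matrix_vector_right_distrib matrix_vector_mult_scaleR matrix_vector_mult_basis)
qed

lemma perceptron_norm_scaled_le:
  assumes unit: "\<And>i. norm (column i A) = 1"
    and p: "0 \<le> p" "p \<noteq> 0" "A *v p = 0"
  shows "(norm (real t *\<^sub>R w t))\<^sup>2 \<le> real t"
proof (induction t)
  \<comment> \<open>The factor \<open>real 0\<close> removes \<open>w 0\<close>, whose norm is 1.
    This agrees with the algorithm, whose first step has weight \<open>1 - 1/1 = 0\<close> on
    \<open>w 0\<close>.\<close>
  case 0
  then show ?case by simp
next
  case (Suc t)
  let ?a = "column (idx (Suc t)) A"
  \<comment> \<open>Scaling by the step count turns averaging into addition of a unit column, so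
    only the cross term needs a sign.\<close>
  have "real (Suc t) *\<^sub>R w (Suc t) = real t *\<^sub>R w t + ?a"
    unfolding perceptron_step by (simp add: scaleR_add_right field_simps)
  then have "(norm (real (Suc t) *\<^sub>R w (Suc t)))\<^sup>2
      = (norm (real t *\<^sub>R w t))\<^sup>2 + 2 * (real t * (w t \<bullet> ?a)) + 1"
    using unit[of "idx (Suc t)"]
    by (simp add: power2_norm_eq_inner inner_add_left inner_add_right inner_commute norm_eq_1 power_mult_distrib
        power2_eq_square[of "real t"] mult.assoc)
  moreover have "w t \<bullet> ?a \<le> 0"
    using exists_column_inner_nonpos[OF p, of "w t"] perceptron_step(3) order_trans by blast
  then have "real t * (w t \<bullet> ?a) \<le> 0" by (simp add: mult_nonneg_nonpos)
  ultimately show ?case using Suc by simp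
qed

lemma perceptron_norm_le:
  assumes "\<And>i. norm (column i A) = 1" "0 \<le> p" "p \<noteq> 0" "A *v p = 0" "t \<ge> 1"
  shows "norm (w t) \<le> 1 / sqrt (real t)"
proof -
  have "real t * norm (w t) \<le> sqrt (real t)"
    using perceptron_norm_scaled_le[of p t] assms real_le_rsqrt by fastforce
  then have "norm (w t) \<le> sqrt (real t) / real t"
    using assms(5) by (simp add: field_simps)
  then show ?thesis
    by (simp add: sqrt_divide_self_eq inverse_eq_divide)
qed

end

theorem corollary1:
  fixes A :: "real^'n^'d"
    and idx :: "nat \<Rightarrow> 'n"
    and w :: "nat \<Rightarrow> real^'d"
    and \<alpha> :: "nat \<Rightarrow> real^'n"
    and W :: "(real^'n) set"
  assumes unit_columns: "\<And>i. norm (column i A) = 1"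
    and dual_feasible: "\<exists>p. 0 \<le> p \<and> p \<noteq> 0 \<and> A *v p = 0"
    and margin: "\<bar>affine_margin_neg A\<bar> > 0"
    and W: "W = {q \<in> prob_simplex. A *v q = 0}"
    and NP: "normalized_perceptron A idx w \<alpha>"
  shows "\<forall>t\<ge>1. dist1 (\<alpha> t) W \<le> 2 / (\<bar>affine_margin_neg A\<bar> * sqrt (real t))"
proof (intro allI impI)
  fix t :: nat assume t: "t \<ge> 1"
  obtain p where p: "0 \<le> p" "p \<noteq> 0" "A *v p = 0" using dual_feasible by blast
  \<comment> \<open>A nonzero \<open>min 0\<close> can only come from a negative margin.\<close>
  have neg: "affine_margin A < 0" and eq: "\<bar>affine_margin_neg A\<bar> = - affine_margin A"
    using margin by (auto simp: affine_margin_neg_def min_def split: if_splits)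
  have "dist1 (\<alpha> t) W \<le> 2 * norm (w t) / - affine_margin A"
    unfolding W perceptron_iterate_eq[OF NP]
    by (intro dist1_kernel_le neg perceptron_coefficients_mem[OF NP])
  also have "\<dots> \<le> 2 * (1 / sqrt (real t)) / - affine_margin A"
    using perceptron_norm_le[OF NP unit_columns p t] neg
    by (intro divide_right_mono mult_left_mono) auto
  finally show "dist1 (\<alpha> t) W \<le> 2 / (\<bar>affine_margin_neg A\<bar> * sqrt (real t))"
    by (simp add: eq mult.commute)
qed

end
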